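(* Let $R=\prod_i p_i^{\alpha_i}$ be an integer $R\ge 2$, where the $p_i$ are distinct primes and the $\alpha_i$ are positive integers, and let $k=\max_i\alpha_i$. Then the iterational depth of the wreath product $\mathbb{Z}\wr\mathbb{Z}/R\mathbb{Z}$ (with $\mathbb{Z}$ the acting group) is $s(\mathbb{Z}\wr\mathbb{Z}/R\mathbb{Z})=k+1$.
   Context: Convention: $\mathbb{Z}\wr\mathbb{Z}/R\mathbb{Z}$ denotes the restricted wreath product in which the first factor $\mathbb{Z}$ acts, i.e. the semidirect product of $\bigoplus_{i\in\mathbb{Z}}\mathbb{Z}/R\mathbb{Z}$ with $\mathbb{Z}$, where $\mathbb{Z}$ acts by shifting coordinates. Let $w=w(x_1,\dots,x_n)$ be a word (element of the free group $F_n$ on $x_1,\dots,x_n$, $n\ge 1$). Its Engel type iterations on the first variable are $w_{\circ 1}=w$ and $w_{\circ (N+1)}(x_1,\dots,x_n)=w(w_{\circ N}(x_1,\dots,x_n),x_2,\dots,x_n)$ for $N\ge 1$. A group $G$ satisfies the ($E$-type) iterated identity $w$ if for all $x_1,\dots,x_n\in G$ there exists $N\ge 1$ with $w_{\circ N}(x_1,\dots,x_n)=e$ in $G$. If $w$ is an iterated identity of $G$, the iterational depth $s(w,G)$ of $w$ in $G$ is the infimum (possibly $+\infty$) of those integers $D\ge 1$ such that for all $x_1,\dots,x_n\in G$ there is $1\le d\le D$ with $w_{\circ d}(x_1,\dots,x_n)=e$. A word is non-trivial if it is not equal to the identity in the free group. The iterational depth of $G$ is $s(G)=\sup_w s(w,G)$,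 the supremum over all non-trivial iterated identities $w$ (in any number of variables) satisfied by $G$; if $G$ satisfies no non-trivial iterated identity, $s(G)=-\infty$. *)

theory Defs
  imports
    "HOL-Algebra.Product_Groups"
    "HOL-Computational_Algebra.Primes"
    "HOL-Library.Extended_Real"
begin

section \<open>Words in the free group\<close>

text \<open>
  The letter \<open>(i, True)\<close> stands for the generator \<open>x\<^sub>i\<close> and \<open>(i, False)\<close> for its inverse.
  A word need not be reduced: elements of the free group are words up to \<open>free_eq\<close>,
  that is, up to inserting and deleting pairs of adjacent mutually inverse letters.
\<close>

type_synonym letter = "nat \<times> bool"
type_synonym word = "letter list"

definition words :: "nat \<Rightarrow> word set" where
  "words n = lists ({1..n} \<times> UNIV)"

definition cancel_step :: "word \<Rightarrow> word \<Rightarrow> bool" where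
  "cancel_step v w \<longleftrightarrow> (\<exists>a b i s. v = a @ [(i, s), (i, \<not> s)] @ b \<and> w = a @ b)"

definition free_eq :: "word \<Rightarrow> word \<Rightarrow> bool" where
  "free_eq = equivclp cancel_step"

definition nontrivial :: "word \<Rightarrow> bool" where
  "nontrivial w \<longleftrightarrow> \<not> free_eq w []"

definition word_inverse :: "word \<Rightarrow> word" where
  "word_inverse w = rev (map (\<lambda>(i, s). (i, \<not> s)) w)"

definition subst_letter :: "(nat \<Rightarrow> word) \<Rightarrow> letter \<Rightarrow> word" where
  "subst_letter \<sigma> l = (if snd l then \<sigma> (fst l) else word_inverse (\<sigma> (fst l)))"

definition subst_word :: "(nat \<Rightarrow> word) \<Rightarrow> word \<Rightarrow> word" where
  "subst_word \<sigma> w = concat (map (subst_letter \<sigma>) w)"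

definition gen :: "nat \<Rightarrow> word" where
  "gen i = [(i, True)]"

text \<open>
  Only the iterates with \<open>N \<ge> 1\<close> are used; setting the iterate number \<open>0\<close> to be \<open>x\<^sub>1\<close> makes
  the first iterate equal to \<open>w\<close>, see \<open>engel_iter_1\<close>.
\<close>

primrec engel_iter :: "word \<Rightarrow> nat \<Rightarrow> word" where
  "engel_iter w 0 = gen 1"
| "engel_iter w (Suc N) = subst_word (gen(1 := engel_iter w N)) w"

lemma subst_word_gen: "subst_word gen w = w"
  by (induction w) (auto simp: subst_word_def subst_letter_def gen_def word_inverse_def)

lemma engel_iter_1: "engel_iter w 1 = w"
  by (simp add: subst_word_gen)

definition letter_eval :: "('a, 'm) monoid_scheme \<Rightarrow> (nat \<Rightarrow> 'a) \<Rightarrow> letter \<Rightarrow> 'a" where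
  "letter_eval G x l = (if snd l then x (fst l) else inv\<^bsub>G\<^esub> (x (fst l)))"

definition word_eval :: "('a, 'm) monoid_scheme \<Rightarrow> (nat \<Rightarrow> 'a) \<Rightarrow> word \<Rightarrow> 'a" where
  "word_eval G x w = foldr (\<lambda>l g. letter_eval G x l \<otimes>\<^bsub>G\<^esub> g) w \<one>\<^bsub>G\<^esub>"

section \<open>Iterated identities and iterational depth\<close>

definition iterated_identity :: "('a, 'm) monoid_scheme \<Rightarrow> nat \<Rightarrow> word \<Rightarrow> bool" where
  "iterated_identity G n w \<longleftrightarrow>
     (\<forall>x \<in> {1..n} \<rightarrow> carrier G. \<exists>N\<ge>1. word_eval G x (engel_iter w N) = \<one>\<^bsub>G\<^esub>)"

text \<open>In \<^typ>\<open>ereal\<close> the infimum of the empty set is \<open>\<infinity>\<close> and its supremum is \<open>-\<infinity>\<close>.\<close>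

definition word_depth :: "('a, 'm) monoid_scheme \<Rightarrow> nat \<Rightarrow> word \<Rightarrow> ereal" where
  "word_depth G n w =
     Inf {ereal (real D) | D :: nat. D \<ge> 1 \<and>
       (\<forall>x \<in> {1..n} \<rightarrow> carrier G. \<exists>d. 1 \<le> d \<and> d \<le> D \<and> word_eval G x (engel_iter w d) = \<one>\<^bsub>G\<^esub>)}"

definition iterational_depth :: "('a, 'm) monoid_scheme \<Rightarrow> ereal" where
  "iterational_depth G =
     Sup {word_depth G n w | n w.
       n \<ge> 1 \<and> w \<in> words n \<and> nontrivial w \<and> iterated_identity G n w}"

section \<open>The wreath product\<close>

definition semidirect_product ::
    "('a, 'm) monoid_scheme \<Rightarrow> ('b, 'k) monoid_scheme \<Rightarrow> ('b \<Rightarrow> 'a \<Rightarrow> 'a) \<Rightarrow> ('a \<times> 'b) monoid" where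
  "semidirect_product N H act =
     \<lparr>carrier = carrier N \<times> carrier H,
      monoid.mult = (\<lambda>(f, a) (g, b). (f \<otimes>\<^bsub>N\<^esub> act a g, a \<otimes>\<^bsub>H\<^esub> b)),
      one = (\<one>\<^bsub>N\<^esub>, \<one>\<^bsub>H\<^esub>)\<rparr>"

definition shift :: "int \<Rightarrow> (int \<Rightarrow> 'a) \<Rightarrow> (int \<Rightarrow> 'a)" where
  "shift a f = (\<lambda>i. f (i - a))"

definition wreath_Z :: "('a, 'm) monoid_scheme \<Rightarrow> ((int \<Rightarrow> 'a) \<times> int) monoid" where
  "wreath_Z B = semidirect_product (sum_group UNIV (\<lambda>_. B)) integer_group shift"

lemma shift_in_sum_group:
  assumes "group B" "f \<in> carrier (sum_group UNIV (\<lambda>_::int. B))"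
  shows "shift a f \<in> carrier (sum_group UNIV (\<lambda>_. B))"
proof -
  have "{i. shift a f i \<noteq> \<one>\<^bsub>B\<^esub>} = (\<lambda>i. i + a) ` {i. f i \<noteq> \<one>\<^bsub>B\<^esub>}"
    by (auto simp: shift_def image_iff) (metis diff_add_cancel)
  then show ?thesis
    using assms by (auto simp: carrier_sum_group shift_def)
qed

lemma group_wreath_Z:
  assumes "group B"
  shows "group (wreath_Z B)"
proof (rule groupI)
  let ?S = "sum_group UNIV (\<lambda>_::int. B)"
  interpret B: group B by fact
  interpret S: group ?S using assms by simp
  note defs = wreath_Z_def semidirect_product_def integer_group_def
  show "x \<otimes>\<^bsub>wreath_Z B\<^esub> y \<in> carrier (wreath_Z B)"
    if "x \<in> carrier (wreath_Z B)" "y \<in> carrier (wreath_Z B)" for x y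
    using that S.m_closed shift_in_sum_group[OF assms]
    by (auto simp: defs simp del: mult_sum_group)
  show "\<one>\<^bsub>wreath_Z B\<^esub> \<in> carrier (wreath_Z B)"
    using S.one_closed by (auto simp: defs simp del: one_sum_group)
  show "x \<otimes>\<^bsub>wreath_Z B\<^esub> y \<otimes>\<^bsub>wreath_Z B\<^esub> z = x \<otimes>\<^bsub>wreath_Z B\<^esub> (y \<otimes>\<^bsub>wreath_Z B\<^esub> z)"
    if "x \<in> carrier (wreath_Z B)" "y \<in> carrier (wreath_Z B)" "z \<in> carrier (wreath_Z B)" for x y z
    using that assms
    by (auto simp: defs shift_def carrier_sum_group PiE_iff B.m_assoc algebra_simps)
  show "\<one>\<^bsub>wreath_Z B\<^esub> \<otimes>\<^bsub>wreath_Z B\<^esub> x = x" if "x \<in> carrier (wreath_Z B)" for x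
    using that assms by (auto simp: defs shift_def carrier_sum_group PiE_iff)
  show "\<exists>y\<in>carrier (wreath_Z B). y \<otimes>\<^bsub>wreath_Z B\<^esub> x = \<one>\<^bsub>wreath_Z B\<^esub>"
    if x: "x \<in> carrier (wreath_Z B)" for x
  proof -
    obtain f a where fa: "x = (f, a)" "f \<in> carrier ?S"
      using x by (auto simp: defs)
    define g where "g = shift (- a) f"
    have g: "g \<in> carrier ?S"
      unfolding g_def by (rule shift_in_sum_group[OF assms fa(2)])
    have "(inv\<^bsub>?S\<^esub> g, - a) \<in> carrier (wreath_Z B)"
      using S.inv_closed[OF g] by (simp add: defs)
    moreover have "(inv\<^bsub>?S\<^esub> g, - a) \<otimes>\<^bsub>wreath_Z B\<^esub> x = \<one>\<^bsub>wreath_Z B\<^esub>"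
      using S.l_inv[OF g]
      by (simp add: defs fa(1) g_def[symmetric] del: mult_sum_group one_sum_group inv_sum_group)
    ultimately show ?thesis by blast
  qed
qed

end

theory Submission
  imports Defs "HOL-Library.Poly_Mapping"
begin

text \<open>
  The wreath product is \<open>A \<rtimes> \<int>\<close> with \<open>A = (\<int>/R)[t, 1/t]\<close>. An iterated identity \<open>w\<close> has total
  exponent \<open>0\<close> in every variable, so from the first iterate on \<open>x\<^sub>1\<close> lies in \<open>A\<close> and \<open>w\<close> acts on it
  as an affine map \<open>f \<mapsto> M f + c\<close>. Starting from \<open>f = 1, c = 0\<close> shows that \<open>M\<close> is nilpotent modulo
  \<open>R\<close>, hence divisible by every prime factor of \<open>R\<close>, hence \<open>M\<^sup>k = 0\<close>; starting from \<open>f = 0\<close> gives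
  \<open>(1 + M + \<dots> + M\<^sup>N\<^sup>-\<^sup>1) c = 0\<close>, so \<open>c = 0\<close>, the first factor being a unit. Thus the first iterate and
  \<open>k\<close> further ones suffice. With \<open>r\<close> the product of the primes dividing \<open>R\<close>, the word
  \<open>[x\<^sub>1, x\<^sub>2]\<^sup>r [[x\<^sub>1, x\<^sub>2], x\<^sub>1]\<close> needs all of them: its first iterate \<open>(r + 1 - t\<^sup>a\<^sup>1) h\<close> need not be divisible
  by any prime, whereas \<open>M = r (1 - t\<^sup>a\<^sup>2)\<close>.
\<close>

section \<open>Laurent polynomials\<close>

type_synonym laurent = "int \<Rightarrow>\<^sub>0 int"

abbreviation lookup :: "laurent \<Rightarrow> int \<Rightarrow> int" where
  "lookup \<equiv> Poly_Mapping.lookup"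

abbreviation T :: "int \<Rightarrow> laurent" where
  "T a \<equiv> Poly_Mapping.single a 1"

lemma T_mult: "T a * T b = T (a + b)"
  by (simp add: mult_single)

lemma T_mult_left: "T a * (T b * f) = T (a + b) * f"
  by (simp add: mult_single flip: mult.assoc)

lemma lookup_mult_keys:
  "lookup (f * g) k = (\<Sum>a\<in>Poly_Mapping.keys f. lookup f a * lookup g (k - a))"
  for f g :: laurent
proof -
  have "Sum_any (\<lambda>q. lookup g q when k = a + q) = lookup g (k - a)" for a
  proof -
    have "Sum_any (\<lambda>q. lookup g q when k = a + q) = Sum_any (\<lambda>q. lookup g q when q = k - a)"
      by (rule Sum_any.cong) (auto simp: when_def)
    then show ?thesis by simp
  qed
  then have "lookup (f * g) k = Sum_any (\<lambda>a. lookup f a * lookup g (k - a))"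
    by (simp add: lookup_mult)
  also have "\<dots> = (\<Sum>a\<in>Poly_Mapping.keys f. lookup f a * lookup g (k - a))"
    by (rule Sum_any.expand_superset) (auto simp: in_keys_iff)
  finally show ?thesis .
qed

lemma lookup_map_laurent: "c 0 = 0 \<Longrightarrow> lookup (Poly_Mapping.map c f) k = c (lookup f k)"
  by (simp add: Poly_Mapping.map.rep_eq when_def)

lemma lookup_single_mult: "lookup (Poly_Mapping.single a c * f) k = c * lookup f (k - a)"
  for f :: laurent
  by (simp add: lookup_mult_keys)

lemma lookup_of_nat_mult: "lookup (of_nat n * f) k = int n * lookup f k"
  for f :: laurent
  using lookup_single_mult[of 0 "int n" f k] by simp

text \<open>Divisibility by \<open>of_nat R\<close> plays the role of vanishing in (Z/R)[t, 1/t]: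
  all computations stay over the integers and are tested modulo R coefficientwise.\<close>

lemma of_nat_dvd_laurent_iff: "of_nat n dvd f \<longleftrightarrow> (\<forall>k. int n dvd lookup f k)"
  for f :: laurent
proof
  assume "\<forall>k. int n dvd lookup f k"
  then have "f = of_nat n * Poly_Mapping.map (\<lambda>c. c div int n) f"
    by (intro poly_mapping_eqI) (simp add: lookup_of_nat_mult lookup_map_laurent)
  then show "of_nat n dvd f" by (rule dvdI)
qed (auto simp: lookup_of_nat_mult)

text \<open>As in Gauss's lemma: after reducing the coefficients modulo \<open>p\<close>, the top coefficient of a product
  is the product of the top coefficients.\<close>

lemma prime_dvd_laurent_mult:
  fixes f g :: laurent
  assumes p: "prime (p :: nat)" and dvd: "of_nat p dvd f * g"
  shows "of_nat p dvd f \<or> of_nat p dvd g"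
proof (rule ccontr)
  assume nd: "\<not> (of_nat p dvd f \<or> of_nat p dvd g)"
  define red where "red h = Poly_Mapping.map (\<lambda>c. c mod int p) h" for h :: laurent
  have lookup_red: "lookup (red h) k = lookup h k mod int p" for h k
    by (simp add: red_def lookup_map_laurent)
  have dvd_red: "of_nat p dvd h - red h" for h
    by (simp add: of_nat_dvd_laurent_iff lookup_minus lookup_red)
  have top: "lookup (red h) (Max (Poly_Mapping.keys (red h))) \<noteq> 0"
    if "\<not> of_nat p dvd h" for h
  proof -
    have "Poly_Mapping.keys (red h) \<noteq> {}"
    proof
      assume "Poly_Mapping.keys (red h) = {}"
      then have "red h = 0" by simp
      with dvd_red[of h] that show False by simp
    qed
    then have "Max (Poly_Mapping.keys (red h)) \<in> Poly_Mapping.keys (red h)" by simp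
    then show ?thesis by (simp add: in_keys_iff)
  qed
  define d e where "d = Max (Poly_Mapping.keys (red f))" and "e = Max (Poly_Mapping.keys (red g))"
  have "f * g - red f * red g = (f - red f) * g + red f * (g - red g)"
    by (simp add: algebra_simps)
  then have "of_nat p dvd f * g - red f * red g"
    using dvd_red[of f] dvd_red[of g] by simp
  with dvd have "of_nat p dvd f * g - (f * g - red f * red g)"
    by (rule dvd_diff)
  then have "int p dvd lookup (red f * red g) (d + e)"
    by (simp add: of_nat_dvd_laurent_iff)
  also have "lookup (red f * red g) (d + e) = (\<Sum>a\<in>{d}. lookup (red f) a * lookup (red g) (d + e - a))"
    unfolding lookup_mult_keys
  proof (rule sum.mono_neutral_right)
    show "{d} \<subseteq> Poly_Mapping.keys (red f)"
      using top nd by (simp add: d_def in_keys_iff)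
    show "\<forall>a\<in>Poly_Mapping.keys (red f) - {d}. lookup (red f) a * lookup (red g) (d + e - a) = 0"
    proof
      fix a assume a: "a \<in> Poly_Mapping.keys (red f) - {d}"
      then have "a < d" using Max_ge[of "Poly_Mapping.keys (red f)" a] by (auto simp: d_def order.strict_iff_order)
      then have "e < d + e - a" by simp
      then have "d + e - a \<notin> Poly_Mapping.keys (red g)"
        using Max_ge[of "Poly_Mapping.keys (red g)" "d + e - a"] by (auto simp flip: e_def)
      then show "lookup (red f) a * lookup (red g) (d + e - a) = 0" by (simp add: in_keys_iff)
    qed
  qed simp
  finally have "int p dvd lookup (red f) d \<or> int p dvd lookup (red g) e"
    using p by (simp add: prime_dvd_mult_iff)
  with top nd show False
    by (auto simp: d_def e_def lookup_red dvd_eq_mod_eq_0)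
qed

section \<open>Nilpotent Laurent polynomials modulo R\<close>

lemma prime_dvd_laurent_power: "prime p \<Longrightarrow> of_nat p dvd f ^ N \<Longrightarrow> of_nat p dvd f"
  for f :: laurent
proof (induction N)
  case 0
  then have "int p dvd lookup 1 0" by (simp only: of_nat_dvd_laurent_iff power_0)
  then have "int p dvd 1" by (simp only: lookup_one_zero)
  with 0 show ?case by simp
next
  case (Suc N)
  then show ?case using prime_dvd_laurent_mult[of p f "f ^ N"] by auto
qed

text \<open>Each p_i divides R, hence M^N, hence M by primality; so p_i^k divides M^k, and with it
  the power of p_i occurring in R. These powers are pairwise coprime, so their product divides as
  well.\<close>

lemma of_nat_dvd_laurent_power:
  fixes M :: laurent
  assumes fin: "finite I" and p: "\<And>i. i \<in> I \<Longrightarrow> prime (p i)" and inj: "inj_on p I"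
    and \<alpha>: "\<And>i. i \<in> I \<Longrightarrow> 0 < \<alpha> i \<and> \<alpha> i \<le> k"
    and dvd: "of_nat (\<Prod>i\<in>I. p i ^ \<alpha> i) dvd M ^ N"
  shows "of_nat (\<Prod>i\<in>I. p i ^ \<alpha> i) dvd M ^ k"
proof -
  have "of_nat (p i ^ \<alpha> i) dvd M ^ k" if i: "i \<in> I" for i
  proof -
    have "p i dvd (\<Prod>i\<in>I. p i ^ \<alpha> i)"
      using i \<alpha>[OF i] fin by (meson dvd_power dvd_prod_eqI dvd_trans dvd_refl dvd_prodI)
    then have "of_nat (p i) dvd M ^ N"
      using dvd by (meson dvd_trans of_nat_dvd_laurent_iff of_nat_dvd_iff)
    then have "of_nat (p i) dvd M" using p[OF i] prime_dvd_laurent_power by blast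
    then have "of_nat (p i) ^ k dvd M ^ k" by (rule dvd_power_same)
    moreover have "(of_nat (p i) :: laurent) ^ \<alpha> i dvd of_nat (p i) ^ k"
      using \<alpha>[OF i] by (simp add: le_imp_power_dvd)
    ultimately show ?thesis by (simp add: dvd_trans)
  qed
  then have dvd_coeff: "int (p i ^ \<alpha> i) dvd lookup (M ^ k) j" if "i \<in> I" for i j
    using that of_nat_dvd_laurent_iff by blast
  \<comment> \<open>Coprime divisors are combined coefficient by coefficient, inside the
    integers.\<close>
  have "(\<Prod>i\<in>J. int (p i ^ \<alpha> i)) dvd lookup (M ^ k) j" if "J \<subseteq> I" for J j
  proof -
    from that fin have "finite J" by (rule finite_subset)
    then show ?thesis using that
    proof (induction J rule: finite_induct)
      case (insert i J)
      have "coprime (int (p i ^ \<alpha> i)) (\<Prod>i\<in>J. int (p i ^ \<alpha> i))"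
      proof (rule prod_coprime_right)
        fix i' assume "i' \<in> J"
        with insert have "p i \<noteq> p i'" using inj by (auto dest: inj_onD)
        with insert \<open>i' \<in> J\<close> have "coprime (p i) (p i')" by (auto intro!: primes_coprime p)
        then show "coprime (int (p i ^ \<alpha> i)) (int (p i' ^ \<alpha> i'))"
          by simp
      qed
      moreover have "int (p i ^ \<alpha> i) dvd lookup (M ^ k) j" "(\<Prod>i\<in>J. int (p i ^ \<alpha> i)) dvd lookup (M ^ k) j"
        using insert dvd_coeff by auto
      ultimately show ?case unfolding prod.insert[OF insert.hyps] by (intro divides_mult)
    qed simp
  qed
  from this[OF order_refl] show ?thesis
    unfolding of_nat_dvd_laurent_iff by (simp only: of_nat_prod simp_thms)
qed

text \<open>Multiplying by 1 - x telescopes the sum, so c = x^N c modulo r, and by iteration c =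
  x^(N k) c. As N \<ge> 1 gives N k \<ge> k, the right side vanishes modulo r.\<close>

lemma dvd_of_dvd_geometric_sum:
  fixes x :: "'a :: comm_ring_1"
  assumes dvd: "r dvd (\<Sum>j<N. x ^ j) * c" and k: "r dvd x ^ k" and N: "N \<ge> 1"
  shows "r dvd c"
proof -
  have "(1 - x) * ((\<Sum>j<N. x ^ j) * c) = c - x ^ N * c"
    using one_diff_power_eq[of x N] by (metis left_diff_distrib mult.assoc mult_1)
  then have step: "r dvd c - x ^ N * c" using dvd by (metis dvd_mult)
  have "r dvd c - x ^ (N * j) * c" for j
  proof (induction j)
    case (Suc j)
    have "c - x ^ (N * Suc j) * c = (c - x ^ (N * j) * c) + x ^ (N * j) * (c - x ^ N * c)"
      by (simp add: algebra_simps power_add)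
    then show ?case using Suc step by (metis dvd_add dvd_mult)
  qed simp
  moreover have "r dvd x ^ (N * k) * c"
    using k N by (metis dvd_mult2 dvd_trans le_imp_power_dvd mult_le_mono1 mult_1)
  ultimately show ?thesis by (metis dvd_add diff_add_cancel)
qed

section \<open>Evaluation of words\<close>

lemma letter_eval_closed:
  "group G \<Longrightarrow> (\<And>i. x i \<in> carrier G) \<Longrightarrow> letter_eval G x l \<in> carrier G"
  by (simp add: letter_eval_def group.inv_closed)

lemma word_eval_Nil [simp]: "word_eval G x [] = \<one>\<^bsub>G\<^esub>"
  by (simp add: word_eval_def)

lemma word_eval_Cons [simp]:
  "word_eval G x (l # w) = letter_eval G x l \<otimes>\<^bsub>G\<^esub> word_eval G x w"
  by (simp add: word_eval_def)

lemma word_eval_closed: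
  "group G \<Longrightarrow> (\<And>i. x i \<in> carrier G) \<Longrightarrow> word_eval G x w \<in> carrier G"
  by (induction w)
    (auto simp: letter_eval_closed group.is_monoid intro!: monoid.m_closed monoid.one_closed)

lemma word_eval_append:
  assumes "group G" "\<And>i. x i \<in> carrier G"
  shows "word_eval G x (v @ w) = word_eval G x v \<otimes>\<^bsub>G\<^esub> word_eval G x w"
proof -
  interpret group G by fact
  show ?thesis
    using assms by (induction v) (auto simp: letter_eval_closed word_eval_closed m_assoc)
qed

lemma word_inverse_Cons: "word_inverse (l # w) = word_inverse w @ [(fst l, \<not> snd l)]"
  by (simp add: word_inverse_def split: prod.split)

lemma word_eval_inverse:
  assumes "group G" "\<And>i. x i \<in> carrier G"
  shows "word_eval G x (word_inverse w) = inv\<^bsub>G\<^esub> word_eval G x w"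
proof -
  interpret group G by fact
  show ?thesis
  proof (induction w)
    case (Cons l w)
    have "letter_eval G x (fst l, \<not> snd l) = inv\<^bsub>G\<^esub> letter_eval G x l"
      using assms(2) by (simp add: letter_eval_def)
    with Cons show ?case
      using assms by (simp add: word_inverse_Cons word_eval_append inv_mult_group letter_eval_closed word_eval_closed)
  qed (simp add: word_inverse_def)
qed

lemma word_eval_subst:
  assumes "group G" "\<And>i. x i \<in> carrier G"
  shows "word_eval G x (subst_word \<sigma> w) = word_eval G (\<lambda>i. word_eval G x (\<sigma> i)) w"
proof (induction w)
  case (Cons l w)
  then show ?case
    using assms
    by (simp add: subst_word_def subst_letter_def letter_eval_def word_eval_append word_eval_inverse)
qed (simp add: subst_word_def)

lemma word_eval_gen:
  "group G \<Longrightarrow> (\<And>i. x i \<in> carrier G) \<Longrightarrow> word_eval G x (gen i) = x i"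
  by (simp add: gen_def letter_eval_def group.is_monoid monoid.r_one)

text \<open>Turns substitution into words into a dynamical system: only the value of x_1 moves, the
  other variables act as parameters.\<close>

lemma word_eval_engel_iter_Suc:
  assumes "group G" "\<And>i. x i \<in> carrier G"
  shows "word_eval G x (engel_iter w (Suc N)) = word_eval G (x(1 := word_eval G x (engel_iter w N))) w"
proof -
  have "(\<lambda>i. word_eval G x ((gen(1 := engel_iter w N)) i)) = x(1 := word_eval G x (engel_iter w N))"
    using assms by (auto simp: word_eval_gen)
  then show ?thesis by (simp add: word_eval_subst[OF assms])
qed

lemma words_iff: "w \<in> words n \<longleftrightarrow> fst ` set w \<subseteq> {1..n}"
  by (auto simp: words_def lists_eq_set mem_Times_iff)

text \<open>Lets an assignment constrained only on {1..n} be exchanged for one given by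
  \<open>proj\<close> at every index, as the evaluation lemmas require.\<close>

lemma word_eval_cong:
  assumes "w \<in> words n" "\<And>i. i \<in> {1..n} \<Longrightarrow> x i = y i"
  shows "word_eval G x w = word_eval G y w"
  using assms(1) by (induction w) (auto simp: words_iff letter_eval_def assms(2))

lemma fst_set_word_inverse [simp]: "fst ` set (word_inverse w) = fst ` set w"
  by (induction w) (auto simp: word_inverse_def)

lemma fst_set_subst_word: "fst ` set (subst_word \<sigma> w) = (\<Union>l\<in>set w. fst ` set (\<sigma> (fst l)))"
proof (induction w)
  case (Cons l w)
  have "fst ` set (subst_letter \<sigma> l) = fst ` set (\<sigma> (fst l))" by (simp add: subst_letter_def)
  with Cons show ?case by (simp add: subst_word_def image_Un)
qed (simp add: subst_word_def)

lemma engel_iter_in_words: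
  assumes "w \<in> words n" "n \<ge> 1"
  shows "engel_iter w N \<in> words n"
proof (induction N)
  case (Suc N)
  then show ?case
    using assms by (fastforce simp: words_iff fst_set_subst_word gen_def image_subset_iff split: if_splits)
qed (use assms in \<open>auto simp: gen_def words_iff\<close>)

text \<open>Serves to certify non-triviality: a word with a value other than the identity in some
  group is not freely trivial.\<close>

lemma word_eval_free_eq:
  assumes G: "group G" "\<And>i. x i \<in> carrier G" and "free_eq v w"
  shows "word_eval G x v = word_eval G x w"
proof -
  interpret group G by fact
  have step: "word_eval G x v = word_eval G x w" if vw: "cancel_step v w" for v w
  proof -
    obtain a b i s where v: "v = a @ [(i, s), (i, \<not> s)] @ b" and w: "w = a @ b"
      using vw by (auto simp: cancel_step_def)
    have "word_eval G x ([(i, s), (i, \<not> s)] @ b) = word_eval G x b"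
      using G by (cases s) (simp_all add: letter_eval_def word_eval_closed flip: m_assoc)
    then show ?thesis
      using G by (simp only: v w word_eval_append)
  qed
  from assms(3) show ?thesis
    unfolding free_eq_def
    by (induction rule: equivclp_induct) (auto dest: step)
qed

section \<open>The wreath product as a quotient\<close>

text \<open>The surjection onto the wreath product from pairs with integer lamp coefficients; it
  postpones the reduction modulo R to the very end.\<close>

definition proj :: "nat \<Rightarrow> laurent \<Rightarrow> int \<Rightarrow> (int \<Rightarrow> int) \<times> int" where
  "proj R f a = (\<lambda>i. lookup f i mod int R, a)"

abbreviation wreath :: "nat \<Rightarrow> ((int \<Rightarrow> int) \<times> int) monoid" where
  "wreath R \<equiv> wreath_Z (integer_mod_group R)"

lemma group_wreath: "group (wreath R)"
  by (simp add: group_wreath_Z)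

lemma carrier_wreath:
  "R > 0 \<Longrightarrow> carrier (wreath R) = {f. range f \<subseteq> {0..<int R} \<and> finite {i. f i \<noteq> 0}} \<times> UNIV"
  by (auto simp: wreath_Z_def semidirect_product_def carrier_sum_group carrier_integer_mod_group PiE_iff
      image_subset_iff)

lemma proj_in_carrier: "R > 0 \<Longrightarrow> proj R f a \<in> carrier (wreath R)"
  by (auto simp: carrier_wreath proj_def intro: finite_subset[OF _ finite_lookup[of f]])

lemma proj_surj:
  assumes "R > 0" "x \<in> carrier (wreath R)"
  obtains f a where "x = proj R f a"
proof -
  from assms have "x = proj R (Abs_poly_mapping (fst x)) (snd x)"
    by (auto simp: carrier_wreath proj_def fun_eq_iff image_subset_iff)
  then show ?thesis by (rule that)
qed

lemma proj_mult: "proj R f a \<otimes>\<^bsub>wreath R\<^esub> proj R g b = proj R (f + T a * g) (a + b)"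
  by (auto simp: wreath_Z_def semidirect_product_def proj_def shift_def lookup_add lookup_single_mult
      mod_add_eq)

lemma proj_0: "proj R 0 0 = \<one>\<^bsub>wreath R\<^esub>"
  by (auto simp: wreath_Z_def semidirect_product_def proj_def)

lemma proj_eq_one_iff: "proj R f a = \<one>\<^bsub>wreath R\<^esub> \<longleftrightarrow> of_nat R dvd f \<and> a = 0"
  by (auto simp: proj_def of_nat_dvd_laurent_iff dvd_eq_mod_eq_0 fun_eq_iff simp flip: proj_0)

lemma proj_inv:
  assumes "R > 0"
  shows "inv\<^bsub>wreath R\<^esub> proj R f a = proj R (- (T (- a) * f)) (- a)"
  using assms by (intro group.inv_equality group_wreath) (simp_all add: proj_mult proj_in_carrier proj_0)

section \<open>Words in coordinates and the orbit of the first variable\<close>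

primrec walk :: "(nat \<Rightarrow> int) \<Rightarrow> word \<Rightarrow> int" where
  "walk a [] = 0"
| "walk a (l # w) = (if snd l then a (fst l) else - a (fst l)) + walk a w"

text \<open>Follows \<open>proj_mult\<close>: the lamps of the remaining word are shifted by the
  letter just read. An inverse letter has lamp part -T(-a) f by \<open>proj_inv\<close>, and the
  common factor T(-a) is pulled out.\<close>

primrec lamps :: "(nat \<Rightarrow> laurent) \<Rightarrow> (nat \<Rightarrow> int) \<Rightarrow> word \<Rightarrow> laurent" where
  "lamps f a [] = 0"
| "lamps f a (l # w) =
     (if snd l then f (fst l) + T (a (fst l)) * lamps f a w else T (- a (fst l)) * (lamps f a w - f (fst l)))"

lemma word_eval_proj:
  "R > 0 \<Longrightarrow> word_eval (wreath R) (\<lambda>i. proj R (f i) (a i)) w = proj R (lamps f a w) (walk a w)"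
  by (induction w) (auto simp: proj_0 letter_eval_def proj_inv proj_mult algebra_simps)

lemma walk_append: "walk a (v @ w) = walk a v + walk a w"
  by (induction v) auto

lemma lamps_append: "lamps f a (v @ w) = lamps f a v + T (walk a v) * lamps f a w"
  by (induction v) (auto simp: distrib_left right_diff_distrib T_mult_left)

text \<open>\<open>lamps f a w\<close> is linear in \<open>f\<close>; the coefficient of \<open>f 1\<close> is the image of the Fox derivative
  of \<open>w\<close> with respect to \<open>x\<^sub>1\<close>.\<close>

definition fox1 :: "(nat \<Rightarrow> int) \<Rightarrow> word \<Rightarrow> laurent" where
  "fox1 = lamps (\<lambda>i. if i = 1 then 1 else 0)"

lemma lamps_upd: "lamps (f(1 := g)) a w = fox1 a w * g + lamps (f(1 := 0)) a w"
  by (induction w) (auto simp: fox1_def algebra_simps)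

text \<open>The coefficient of b is the exponent sum of x_1 in w.\<close>

lemma walk_upd: "walk (a(1 := b)) w = walk (\<lambda>i. if i = 1 then 1 else 0) w * b + walk (a(1 := 0)) w"
  by (induction w) (auto simp: algebra_simps)

text \<open>The successive values of x_1 before reduction modulo R. Index 0 is x_1 itself, in step
  with \<open>engel_iter\<close>.\<close>

primrec engel_orbit :: "(nat \<Rightarrow> laurent) \<Rightarrow> (nat \<Rightarrow> int) \<Rightarrow> word \<Rightarrow> nat \<Rightarrow> laurent \<times> int" where
  "engel_orbit f a w 0 = (f 1, a 1)"
| "engel_orbit f a w (Suc N) =
     (let (g, b) = engel_orbit f a w N in (lamps (f(1 := g)) (a(1 := b)) w, walk (a(1 := b)) w))"

lemma word_eval_engel_iter_proj:
  assumes "R > 0"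
  shows "word_eval (wreath R) (\<lambda>i. proj R (f i) (a i)) (engel_iter w N)
    = (case engel_orbit f a w N of (g, b) \<Rightarrow> proj R g b)"
proof (induction N)
  case 0
  then show ?case using assms by (simp add: word_eval_gen group_wreath proj_in_carrier)
next
  case (Suc N)
  obtain g b where gb: "engel_orbit f a w N = (g, b)" by fastforce
  have "(\<lambda>i. proj R (f i) (a i))(1 := proj R g b) = (\<lambda>i. proj R ((f(1 := g)) i) ((a(1 := b)) i))"
    by auto
  then show ?case
    using assms Suc
    by (simp add: word_eval_engel_iter_Suc group_wreath proj_in_carrier gb word_eval_proj
        del: engel_iter.simps fun_upd_apply)
qed

definition dies :: "nat \<Rightarrow> laurent \<times> int \<Rightarrow> bool" where
  "dies R s \<longleftrightarrow> of_nat R dvd fst s \<and> snd s = 0"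

lemma word_eval_engel_iter_eq_one_iff:
  assumes "R > 0"
  shows "word_eval (wreath R) (\<lambda>i. proj R (f i) (a i)) (engel_iter w N) = \<one>\<^bsub>wreath R\<^esub>
    \<longleftrightarrow> dies R (engel_orbit f a w N)"
  using assms by (auto simp: word_eval_engel_iter_proj dies_def proj_eq_one_iff split: prod.splits)

text \<open>The predicate P leaves the range of N open, so that the same transfer serves both the
  iterated identity and the bound in the depth.\<close>

lemma all_wreath_iff:
  assumes R: "R > 0" and w: "w \<in> words n" and n: "n \<ge> 1"
  shows "(\<forall>x\<in>{1..n} \<rightarrow> carrier (wreath R). \<exists>N. P N \<and> word_eval (wreath R) x (engel_iter w N) = \<one>\<^bsub>wreath R\<^esub>)
    \<longleftrightarrow> (\<forall>f a. \<exists>N. P N \<and> dies R (engel_orbit f a w N))" (is "?L \<longleftrightarrow> ?R")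
proof
  assume L: ?L
  show ?R
  proof (intro allI)
    fix f a
    from L[rule_format, of "\<lambda>i. proj R (f i) (a i)"] R
    show "\<exists>N. P N \<and> dies R (engel_orbit f a w N)"
      by (auto simp: proj_in_carrier word_eval_engel_iter_eq_one_iff)
  qed
next
  assume r: ?R
  show ?L
  proof
    fix x assume "x \<in> {1..n} \<rightarrow> carrier (wreath R)"
    then have "\<forall>i\<in>{1..n}. \<exists>f a. x i = proj R f a"
      using proj_surj[OF R] by (metis PiE)
    then obtain f a where fa: "\<And>i. i \<in> {1..n} \<Longrightarrow> x i = proj R (f i) (a i)" by metis
    from r obtain N where "P N" "dies R (engel_orbit f a w N)" by blast
    moreover have "word_eval (wreath R) x (engel_iter w N)
        = word_eval (wreath R) (\<lambda>i. proj R (f i) (a i)) (engel_iter w N)"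
      using engel_iter_in_words[OF w n] fa by (rule word_eval_cong)
    ultimately show "\<exists>N. P N \<and> word_eval (wreath R) x (engel_iter w N) = \<one>\<^bsub>wreath R\<^esub>"
      using word_eval_engel_iter_eq_one_iff[OF R] by auto
  qed
qed

section \<open>The upper bound\<close>

text \<open>If only x_1 has a non-zero Z-coordinate, namely 1, the N-th iterate has Z-coordinate e^N
  with e the exponent sum of x_1; hence e = 0, and \<open>walk a w\<close> is independent of the
  entry of a at 1.\<close>

lemma walk_eq_0:
  assumes dies: "\<And>f a. \<exists>N\<ge>1. dies R (engel_orbit f a w N)"
  shows "walk a w = 0"
proof -
  define \<delta> :: "nat \<Rightarrow> int" where "\<delta> = (\<lambda>i. if i = 1 then 1 else 0)"
  have "\<delta>(1 := 0) = (\<lambda>i. 0)" by (auto simp: \<delta>_def)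
  moreover have "walk (\<lambda>i. 0) w = 0" by (induction w) auto
  ultimately have "walk (\<delta>(1 := b)) w = walk \<delta> w * b" for b
    using walk_upd[of \<delta> b w] by (simp add: \<delta>_def)
  then have "snd (engel_orbit f \<delta> w N) = walk \<delta> w ^ N" for f N
    by (induction N) (auto simp: Let_def split: prod.split, simp add: \<delta>_def)
  moreover obtain N where "dies R (engel_orbit (\<lambda>i. 0) \<delta> w N)" using dies by blast
  ultimately have "walk \<delta> w = 0" by (simp add: dies_def)
  then have upd: "walk (a(1 := b)) w = walk a w" for b
    using walk_upd[of a b w] walk_upd[of a "a 1" w] by (simp add: \<delta>_def)
  \<comment> \<open>From the first iterate on the Z-coordinate is constantly
    \<open>walk a w\<close>, so dying at any N \<ge> 1 forces it to be 0.\<close>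
  obtain N where "N \<ge> 1" "dies R (engel_orbit (\<lambda>i. 0) a w N)" using dies by blast
  then show ?thesis
    by (cases N) (auto simp: dies_def upd[unfolded One_nat_def] Let_def split: prod.splits)
qed

lemma engel_orbit_Suc:
  assumes "snd (engel_orbit f a w N) = 0"
  shows "fst (engel_orbit f a w (Suc N))
    = fox1 (a(1 := 0)) w * fst (engel_orbit f a w N) + lamps (f(1 := 0)) (a(1 := 0)) w"
proof -
  obtain g where "engel_orbit f a w N = (g, 0)" using assms by (metis prod.collapse)
  then show ?thesis using lamps_upd[of f g] by simp
qed

text \<open>The factorisation of R enters only through \<open>power\<close>. The \<open>Suc\<close>
  counts the first iterate, which brings x_1 into the base group; k applications of the affine map
  follow.\<close>

lemma dies_bound:
  assumes dies: "\<And>f a. \<exists>N\<ge>1. dies R (engel_orbit f a w N)"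
    and power: "\<And>M N. of_nat R dvd (M :: laurent) ^ N \<Longrightarrow> of_nat R dvd M ^ k"
  shows "dies R (engel_orbit f a w (Suc k))"
proof -
  \<comment> \<open>Starting from b, the test orbits lie in the base group already at index 0, and
    obey the same affine map as the later iterates for a.\<close>
  define b where "b = a(1 := 0)"
  define M where "M = fox1 b w"
  define c where "c = lamps (f(1 := 0)) b w"
  have snd_0: "snd (engel_orbit f a w (Suc N)) = 0" for f a N
    using walk_eq_0[OF dies] by (simp add: Let_def split: prod.split)
  have b: "b(1 := 0) = b" by (simp add: b_def)
  have snd_b: "snd (engel_orbit f b w N) = 0" for f N
    by (cases N) (use snd_0 in \<open>simp_all add: b_def del: engel_orbit.simps(2)\<close>)
  have "\<exists>N. of_nat R dvd M ^ N"
  proof -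
    \<comment> \<open>With no lamps in the other variables the constant term vanishes, so the orbit
      of 1 consists of the powers of M.\<close>
    define \<delta> :: "nat \<Rightarrow> laurent" where "\<delta> = (\<lambda>i. if i = 1 then 1 else 0)"
    have "\<delta>(1 := 0) = (\<lambda>i. 0)" by (auto simp: \<delta>_def)
    moreover have "lamps (\<lambda>i. 0) b w = 0" by (induction w) auto
    ultimately have "fst (engel_orbit \<delta> b w N) = M ^ N" for N
      by (induction N) (simp_all add: engel_orbit_Suc[OF snd_b] b[unfolded One_nat_def] M_def \<delta>_def del: engel_orbit.simps(2))
    with dies[of \<delta> b] show ?thesis by (auto simp: dies_def)
  qed
  then have M: "of_nat R dvd M ^ k" using power by blast
  have c: "of_nat R dvd c"
  proof -
    \<comment> \<open>Started at 0, the orbit accumulates only the constant term.\<close>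
    define g where "g = f(1 := 0)"
    have g: "g(1 := 0) = g" by (simp add: g_def)
    have "fst (engel_orbit g b w N) = (\<Sum>j<N. M ^ j) * c" for N
    proof (induction N)
      case (Suc N)
      have "fst (engel_orbit g b w (Suc N)) = (1 + M * (\<Sum>j<N. M ^ j)) * c"
        by (simp add: engel_orbit_Suc[OF snd_b] Suc b[unfolded One_nat_def] g[unfolded One_nat_def] algebra_simps M_def c_def flip: g_def[unfolded One_nat_def]
            del: engel_orbit.simps(2))
      also have "1 + M * (\<Sum>j<N. M ^ j) = (\<Sum>j<Suc N. M ^ j)"
        by (simp only: sum.lessThan_Suc_shift sum_distrib_left power_Suc power_0)
      finally show ?case .
    qed (simp add: g_def)
    with dies[of g b] obtain N where "N \<ge> 1" "of_nat R dvd (\<Sum>j<N. M ^ j) * c"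
      by (auto simp: dies_def)
    then show ?thesis using dvd_of_dvd_geometric_sum M by blast
  qed
  \<comment> \<open>The comparison starts at the first iterate, since x_1 itself may lie outside the
    base group.\<close>
  have "of_nat R dvd fst (engel_orbit f a w (Suc N)) - M ^ N * fst (engel_orbit f a w 1)" for N
  proof (induction N)
    case (Suc N)
    have "fst (engel_orbit f a w (Suc (Suc N))) = M * fst (engel_orbit f a w (Suc N)) + c"
      unfolding M_def c_def b_def by (rule engel_orbit_Suc[OF snd_0])
    then have "fst (engel_orbit f a w (Suc (Suc N))) - M ^ Suc N * fst (engel_orbit f a w 1)
        = M * (fst (engel_orbit f a w (Suc N)) - M ^ N * fst (engel_orbit f a w 1)) + c"
      by (simp add: algebra_simps del: engel_orbit.simps(2))
    then show ?case using Suc c by (simp del: engel_orbit.simps(2))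
  qed simp
  then have "of_nat R dvd fst (engel_orbit f a w (Suc k))"
    using M by (metis diff_add_cancel dvd_add dvd_mult2)
  then show ?thesis using snd_0 by (simp add: dies_def)
qed

section \<open>The lower bound\<close>

definition comm12 :: word where
  "comm12 = [(1, True), (2, True), (1, False), (2, False)]"

text \<open>The double commutator contributes the coefficient 1 - T (a 1). It keeps the first
  iterate from being a multiple of r, yet vanishes once x_1 lies in the base group, where only the
  factor r (1 - T (a 2)) remains.\<close>

definition deep_word :: "nat \<Rightarrow> word" where
  "deep_word r = concat (replicate r comm12) @ comm12 @ [(1, True)] @ word_inverse comm12 @ [(1, False)]"

lemma walk_comm12: "walk a comm12 = 0"
  by (simp add: comm12_def)

lemma lamps_comm12: "lamps f a comm12 = (1 - T (a 2)) * f 1 + (T (a 1) - 1) * f 2"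
  by (simp add: comm12_def algebra_simps T_mult_left T_mult)

lemma walk_power_comm12: "walk a (concat (replicate r comm12)) = 0"
  by (induction r) (auto simp: walk_append walk_comm12)

lemma lamps_power_comm12: "lamps f a (concat (replicate r comm12)) = of_nat r * lamps f a comm12"
  by (induction r) (auto simp: lamps_append walk_comm12 algebra_simps)

lemma walk_deep_word: "walk a (deep_word r) = 0"
  by (simp add: deep_word_def walk_append walk_power_comm12) (simp add: comm12_def word_inverse_def)

lemma lamps_deep_word:
  "lamps f a (deep_word r)
    = (of_nat r + 1 - T (a 1)) * ((1 - T (a 2)) * f 1 + (T (a 1) - 1) * f 2)"
proof -
  have "lamps f a (comm12 @ [(1, True)] @ word_inverse comm12 @ [(1, False)])
      = (1 - T (a 1)) * ((1 - T (a 2)) * f 1 + (T (a 1) - 1) * f 2)"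
    by (simp add: comm12_def word_inverse_def algebra_simps T_mult_left T_mult)
  then show ?thesis
    by (simp add: deep_word_def lamps_append walk_power_comm12 lamps_power_comm12 lamps_comm12 algebra_simps)
qed

lemma deep_word_in_words: "deep_word r \<in> words 2"
proof -
  have "fst ` set comm12 \<subseteq> {1..2}" by (simp add: comm12_def)
  then show ?thesis by (simp add: deep_word_def words_iff image_Un) (auto simp: image_subset_iff)
qed

text \<open>After the first iterate x_1 has Z-coordinate 0, so the term in f 2 disappears and the
  iteration is purely linear.\<close>

lemma engel_orbit_deep_word:
  "engel_orbit f a (deep_word r) (Suc N)
    = ((of_nat r * (1 - T (a 2))) ^ N * lamps f a (deep_word r), 0)"
  by (induction N) (simp_all add: walk_deep_word lamps_deep_word algebra_simps)

text \<open>Here x_1 is a pure shift and x_2 a shift with one lamp, so the first iterate is (r + 1 -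
  t)(t - 1). Since p divides r exactly once, N further iterates gain exactly the factor p^N, too
  little for p^k.\<close>

lemma engel_orbit_deep_word_survives:
  assumes p: "prime p" and r: "r = p * s" "\<not> p dvd s" and N: "N < k" and R: "p ^ k dvd R"
  shows "\<not> dies R (engel_orbit (\<lambda>i. if i = 2 then 1 else 0) (\<lambda>_. 1) (deep_word r) (Suc N))"
proof
  let ?q = "of_nat p :: laurent"
  define Q where "Q = (of_nat s * (1 - T 1)) ^ N * ((of_nat r + 1 - T 1) * (T 1 - 1))"
  assume "dies R (engel_orbit (\<lambda>i. if i = 2 then 1 else 0) (\<lambda>_. 1) (deep_word r) (Suc N))"
  then have "of_nat R dvd (of_nat r * (1 - T 1)) ^ N * ((of_nat r + 1 - T 1) * (T 1 - 1))"
    by (simp add: dies_def engel_orbit_deep_word lamps_deep_word del: engel_orbit.simps(2))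
  also have "(of_nat r * (1 - T 1)) ^ N * ((of_nat r + 1 - T 1) * (T 1 - 1)) = ?q ^ N * Q"
    by (simp add: Q_def r(1) power_mult_distrib mult.assoc)
  finally have "of_nat R dvd ?q ^ N * Q" .
  moreover have "p ^ Suc N dvd R"
    using N R by (meson Suc_leI dvd_trans le_imp_power_dvd)
  then have "of_nat (p ^ Suc N) dvd (of_nat R :: laurent)"
    by (auto elim: dvdE)
  \<comment> \<open>As N < k, one factor p is left over after cancelling p^N, and it would have to
    divide Q.\<close>
  ultimately have "?q ^ N * ?q dvd ?q ^ N * Q"
    by (metis dvd_trans mult.commute of_nat_power power_Suc)
  moreover have "?q \<noteq> 0" using p by (simp add: prime_gt_0_nat)
  ultimately have "?q dvd Q" by simp
  then consider "?q dvd of_nat s" | "?q dvd 1 - T 1" | "?q dvd of_nat r + 1 - T 1" | "?q dvd T 1 - 1"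
    unfolding Q_def using prime_dvd_laurent_mult[OF p] prime_dvd_laurent_power[OF p] by metis
  \<comment> \<open>Every candidate factor has a coefficient prime to p: s in the first case, 1 or
    -1 in the others.\<close>
  then show False
  proof cases
    case 1
    then have "int p dvd lookup (of_nat s) 0" unfolding of_nat_dvd_laurent_iff by blast
    with r(2) show False by (simp add: lookup_of_nat)
  next
    case 2
    then have "int p dvd lookup (1 - T 1) 0" unfolding of_nat_dvd_laurent_iff by blast
    with p show False by (simp add: lookup_minus lookup_single)
  next
    case 3
    then have "int p dvd lookup (of_nat r + 1 - T 1) 1" unfolding of_nat_dvd_laurent_iff by blast
    with p show False by (simp add: lookup_minus lookup_add lookup_single lookup_of_nat lookup_one)
  next
    case 4
    then have "int p dvd lookup (T 1 - 1) 0" unfolding of_nat_dvd_laurent_iff by blast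
    with p show False by (simp add: lookup_minus lookup_single)
  qed
qed

section \<open>The iterational depth\<close>

lemma iterated_identity_wreath_iff:
  assumes "R > 0" "w \<in> words n" "n \<ge> 1"
  shows "iterated_identity (wreath R) n w \<longleftrightarrow> (\<forall>f a. \<exists>N\<ge>1. dies R (engel_orbit f a w N))"
  unfolding iterated_identity_def by (rule all_wreath_iff[OF assms])

lemma word_depth_wreath:
  assumes "R > 0" "w \<in> words n" "n \<ge> 1"
  shows "word_depth (wreath R) n w
    = Inf {ereal (real D) | D. D \<ge> 1 \<and> (\<forall>f a. \<exists>d. (1 \<le> d \<and> d \<le> D) \<and> dies R (engel_orbit f a w d))}"
  unfolding word_depth_def conj_assoc[symmetric] all_wreath_iff[OF assms] ..

theorem proposition6p3:
  fixes R k m :: nat and p \<alpha> :: "nat \<Rightarrow> nat"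
  assumes "R \<ge> 2"
    and "R = (\<Prod>i\<in>{1..m}. p i ^ \<alpha> i)"
    and "\<And>i. i \<in> {1..m} \<Longrightarrow> prime (p i)"
    and "inj_on p {1..m}"
    and "\<And>i. i \<in> {1..m} \<Longrightarrow> \<alpha> i > 0"
    and "k = Max (\<alpha> ` {1..m})"
  shows "iterational_depth (wreath_Z (integer_mod_group R)) = ereal (real (k + 1))"
proof (rule antisym)
  have R: "R > 0" using assms(1) by simp
  have ne: "{1..m} \<noteq> {}"
  proof
    assume "{1..m} = {}"
    with assms(1,2) show False by simp
  qed
  have \<alpha>: "0 < \<alpha> i \<and> \<alpha> i \<le> k" if "i \<in> {1..m}" for i
    using that assms(5,6) by simp
  have "k \<in> \<alpha> ` {1..m}"
    unfolding assms(6) using ne by (intro Max_in) auto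
  then obtain j where j: "j \<in> {1..m}" "\<alpha> j = k" by blast
  have power: "of_nat R dvd M ^ k" if "of_nat R dvd M ^ N" for M :: laurent and N
    using of_nat_dvd_laurent_power[of "{1..m}" p \<alpha> k M N] assms(2-4) \<alpha> that by simp

  \<comment> \<open>Upper bound k + 1\<close>
  show "iterational_depth (wreath R) \<le> ereal (real (k + 1))"
    unfolding iterational_depth_def
  proof (rule Sup_least, clarify)
    fix n w assume w: "n \<ge> 1" "w \<in> words n" "iterated_identity (wreath R) n w"
    then have "\<exists>N\<ge>1. dies R (engel_orbit f a w N)" for f a
      using iterated_identity_wreath_iff[OF R] by blast
    then have "dies R (engel_orbit f a w (k + 1))" for f a
      using dies_bound[OF _ power, where w = w] by simp
    then show "word_depth (wreath R) n w \<le> ereal (real (k + 1))"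
      unfolding word_depth_wreath[OF R w(2,1)] by (intro Inf_lower CollectI exI[of _ "k + 1"]) auto
  qed

  \<comment> \<open>A word of depth k + 1\<close>
  define r where "r = (\<Prod>i\<in>{1..m}. p i)"
  define w where "w = deep_word r"
  note w_in_words = deep_word_in_words[of r, folded w_def]
  \<comment> \<open>Each prime occurs once in r and at most k times in R.\<close>
  have "R dvd r ^ k"
    unfolding assms(2) r_def prod_power_distrib
    using \<alpha> by (intro prod_dvd_prod) (simp add: le_imp_power_dvd)
  then have "of_nat R dvd (of_nat r ^ k :: laurent)"
    by (metis dvdE dvd_triv_left of_nat_mult of_nat_power)
  then have dies: "dies R (engel_orbit f a w (k + 1))" for f a
    by (simp add: dies_def w_def engel_orbit_deep_word power_mult_distrib del: engel_orbit.simps(2))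
  have survives: "\<not> dies R (engel_orbit (\<lambda>i. if i = 2 then 1 else 0) (\<lambda>_. 1) w d)" if "1 \<le> d" "d \<le> k" for d
  proof -
    define s where "s = (\<Prod>i\<in>{1..m} - {j}. p i)"
    have "\<not> p j dvd s"
    proof
      assume "p j dvd s"
      then have "\<exists>i\<in>{1..m} - {j}. p j dvd p i"
        using assms(3) j(1) by (simp add: s_def prime_dvd_prod_iff)
      then obtain i where "i \<in> {1..m} - {j}" "p j dvd p i" ..
      then have "p j = p i" using primes_dvd_imp_eq[of "p j" "p i"] assms(3) j(1) by simp
      then have "j = i"
        by (rule inj_onD[OF assms(4)]) (use j(1) \<open>i \<in> {1..m} - {j}\<close> in auto)
      with \<open>i \<in> {1..m} - {j}\<close> show False by simp
    qed
    moreover have "r = p j * s"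
      unfolding r_def s_def using j(1) by (intro prod.remove) auto
    moreover have "p j ^ k dvd R"
      unfolding assms(2) j(2)[symmetric] using j(1) by (intro dvd_prodI) simp_all
    moreover have "d - 1 < k" "Suc (d - 1) = d" using that by auto
    ultimately show ?thesis
      using engel_orbit_deep_word_survives[OF assms(3)[OF j(1)]] unfolding w_def by metis
  qed
  \<comment> \<open>The first iterate is w itself, and it survives because k \<ge> 1.\<close>
  have "nontrivial w"
    unfolding nontrivial_def
  proof
    define x where "x = (\<lambda>i::nat. proj R (if i = 2 then 1 else 0) 1)"
    assume "free_eq w []"
    then have "word_eval (wreath R) x w = \<one>\<^bsub>wreath R\<^esub>"
      using word_eval_free_eq[OF group_wreath, of x R w "[]"] R by (simp add: x_def proj_in_carrier)
    then have "dies R (engel_orbit (\<lambda>i. if i = 2 then 1 else 0) (\<lambda>_. 1) w 1)"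
      unfolding x_def word_eval_engel_iter_eq_one_iff[OF R, symmetric] engel_iter_1 .
    with survives[of 1] \<alpha>[OF j(1)] j(2) show False by simp
  qed
  moreover have "iterated_identity (wreath R) 2 w"
    unfolding iterated_identity_wreath_iff[OF R w_in_words one_le_numeral]
    using dies by (intro allI exI[of _ "k + 1"]) simp
  ultimately have "word_depth (wreath R) 2 w \<le> iterational_depth (wreath R)"
    unfolding iterational_depth_def using w_in_words
    by (intro Sup_upper CollectI exI[of _ "2 :: nat"] exI[of _ w]) simp
  moreover have "ereal (real (k + 1)) \<le> word_depth (wreath R) 2 w"
    unfolding word_depth_wreath[OF R w_in_words one_le_numeral]
  \<comment> \<open>A single assignment survives the first k iterates, so every admissible D exceeds
    k.\<close>
  proof (rule Inf_greatest, clarify)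
    fix D :: nat
    assume "\<forall>f a. \<exists>d. (1 \<le> d \<and> d \<le> D) \<and> dies R (engel_orbit f a w d)"
    then obtain d where "1 \<le> d" "d \<le> D"
      "dies R (engel_orbit (\<lambda>i. if i = 2 then 1 else 0) (\<lambda>_. 1) w d)" by blast
    moreover from this have "\<not> d \<le> k" using survives by blast
    ultimately show "ereal (real (k + 1)) \<le> ereal (real D)" by simp
  qed
  ultimately show "ereal (real (k + 1)) \<le> iterational_depth (wreath R)"
    by (rule order_trans[rotated])
qed

end
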